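(* For every integer $m\ge 1$ there exists a system of bilinear equations in $2m$ variables $x_1,\dots,x_{2m}$, of the form $$\sum_{\alpha\in S}a_{i\alpha}x^\alpha=b_i,\qquad i=1,\dots,\ell,$$ with all $a_{i\alpha}\ge 0$ and all $b_i>0$, which has exactly $\binom{2m-2}{m-1}$ positive real solutions, i.e. solutions in $\mathbb{R}_{>0}^{2m}$.
   Context: Here $S$ is a finite set of exponent vectors in $\mathbb{Z}_{\ge0}^{2m}$, $x^\alpha=\prod_i x_i^{\alpha_i}$, and $a_{i\alpha}$, $b_i$ are real numbers. An equation is called bilinear here if it has degree at most one in each of the two groups of variables $x_1,\dots,x_m$ and $x_{m+1},\dots,x_{2m}$, i.e. every $\alpha\in S$ satisfies $\alpha_1+\dots+\alpha_m\le 1$ and $\alpha_{m+1}+\dots+\alpha_{2m}\le 1$. *)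

theory Defs
  imports Complex_Main "HOL-Library.FuncSet"
begin

text \<open>
  Vectors of length \<open>n\<close> are functions in \<open>{1..n} \<rightarrow>\<^sub>E A\<close>: they are \<open>undefined\<close> outside
  \<open>{1..n}\<close>, so that distinct functions are distinct vectors and cardinalities of
  solution sets are meaningful.
\<close>

definition exponent_vectors :: "nat \<Rightarrow> (nat \<Rightarrow> nat) set" where
  "exponent_vectors n = {1..n} \<rightarrow>\<^sub>E UNIV"

definition positive_vectors :: "nat \<Rightarrow> (nat \<Rightarrow> real) set" where
  "positive_vectors n = {1..n} \<rightarrow>\<^sub>E {0<..}"

definition monomial :: "nat \<Rightarrow> (nat \<Rightarrow> real) \<Rightarrow> (nat \<Rightarrow> nat) \<Rightarrow> real" where
  "monomial n x \<alpha> = (\<Prod>i = 1..n. x i ^ \<alpha> i)"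

definition bilinear_exponents :: "nat \<Rightarrow> (nat \<Rightarrow> nat) set \<Rightarrow> bool" where
  "bilinear_exponents m S \<longleftrightarrow>
     (\<forall>\<alpha>\<in>S. (\<Sum>j = 1..m. \<alpha> j) \<le> 1 \<and> (\<Sum>j = m + 1..2 * m. \<alpha> j) \<le> 1)"

definition positive_solutions ::
    "nat \<Rightarrow> (nat \<Rightarrow> nat) set \<Rightarrow> nat \<Rightarrow> (nat \<Rightarrow> (nat \<Rightarrow> nat) \<Rightarrow> real) \<Rightarrow> (nat \<Rightarrow> real) \<Rightarrow> (nat \<Rightarrow> real) set" where
  "positive_solutions n S l a b =
     {x \<in> positive_vectors n. \<forall>i\<in>{1..l}. (\<Sum>\<alpha>\<in>S. a i \<alpha> * monomial n x \<alpha>) = b i}"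

end

theory Submission
  imports Defs "HOL-Computational_Algebra.Polynomial"
begin

text \<open>
  Read the two groups of variables as the coefficient vectors of two real polynomials
  \<open>p\<close> and \<open>q\<close> of degree at most \<open>m - 1\<close>. Comparing coefficients in
  \<open>p * q = (\<Prod>i = 1..2 * m - 2. z + i)\<close> gives bilinear equations with coefficients 0 and 1
  and positive right-hand sides, and \<open>x m = 1\<close> makes \<open>p\<close> monic. A solution
  amounts to a choice of \<open>m - 1\<close> of the \<open>2 * m - 2\<close> simple real roots for \<open>p\<close>; all roots being
  negative, the coefficients of both factors are automatically positive.
\<close>

section \<open>Monic polynomials with negative integer roots\<close>

definition neg_root_poly :: "nat set \<Rightarrow> real poly" where
  "neg_root_poly I = (\<Prod>i\<in>I. [:real i, 1:])"

lemma degree_neg_root_poly: "degree (neg_root_poly I) = card I"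
  unfolding neg_root_poly_def by (subst degree_prod_eq_sum_degree) auto

lemma lead_coeff_neg_root_poly: "coeff (neg_root_poly I) (card I) = 1"
proof -
  have "lead_coeff (neg_root_poly I) = 1"
    unfolding neg_root_poly_def lead_coeff_prod by simp
  then show ?thesis by (simp add: degree_neg_root_poly)
qed

lemma poly_neg_root_poly_eq_0_iff:
  "finite I \<Longrightarrow> poly (neg_root_poly I) (- real i) = 0 \<longleftrightarrow> i \<in> I"
  by (auto simp: neg_root_poly_def poly_prod)

text \<open>Each further factor \<open>z + i\<close> with \<open>i > 0\<close> turns a coefficient
  into \<open>i\<close> times itself plus its predecessor, so positivity is inherited.\<close>

lemma coeff_neg_root_poly_pos:
  assumes "finite I" "0 \<notin> I" "k \<le> card I"
  shows "coeff (neg_root_poly I) k > 0"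
  using assms
proof (induction I arbitrary: k rule: finite_induct)
  case empty
  then show ?case by (simp add: neg_root_poly_def)
next
  case (insert i I)
  have eq: "neg_root_poly (insert i I) = [:real i, 1:] * neg_root_poly I"
    using insert.hyps by (simp add: neg_root_poly_def)
  \<comment> \<open>The new top coefficient needs this: there \<open>k\<close> exceeds the old
    degree, the old coefficient is 0, and only the shifted one is positive.\<close>
  have nonneg: "coeff (neg_root_poly I) k \<ge> 0" for k
    using insert.IH[of k] insert.prems(1) degree_neg_root_poly[of I] coeff_eq_0[of "neg_root_poly I" k]
    by (cases "k \<le> card I") auto
  have "i > 0" using insert.prems by auto
  show ?case
  proof (cases k)
    case 0
    then show ?thesis using insert.IH[of 0] insert.prems \<open>i > 0\<close> by (simp add: eq)
  next
    case (Suc l)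
    then have "coeff (neg_root_poly I) l > 0"
      using insert.IH[of l] insert.prems insert.hyps by simp
    then show ?thesis using nonneg[of k] \<open>i > 0\<close> by (simp add: eq Suc add_nonneg_pos)
  qed
qed

text \<open>The difference of the two sides has degree below \<open>card I\<close> (or is zero) but
  vanishes at the \<open>card I\<close> distinct points \<open>- i\<close>.\<close>

lemma eq_neg_root_polyI:
  assumes "finite I" "degree p \<le> card I" "coeff p (card I) = 1"
    and "\<And>i. i \<in> I \<Longrightarrow> poly p (- real i) = 0"
  shows "p = neg_root_poly I"
proof (rule poly_eqI_degree_lead_coeff[where n = "card I" and A = "(\<lambda>i. - real i) ` I"])
  show "card I \<le> card ((\<lambda>i. - real i) ` I)"
    by (subst card_image) (auto simp: inj_on_def)
qed (use assms in \<open>auto simp: degree_neg_root_poly lead_coeff_neg_root_poly poly_neg_root_poly_eq_0_iff\<close>)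

text \<open>Each of the \<open>2 * n\<close> roots belongs to \<open>p\<close> or \<open>q\<close>,
  and neither factor can have more than \<open>n\<close> roots, so the two root sets partition all
  the roots.\<close>

lemma neg_root_poly_factorization:
  assumes "degree p \<le> n" "degree q \<le> n" "coeff p n = 1"
    and pq: "p * q = neg_root_poly {1..2 * n}"
  obtains I where "I \<subseteq> {1..2 * n}" "card I = n"
    "p = neg_root_poly I" "q = neg_root_poly ({1..2 * n} - I)"
proof -
  \<comment> \<open>The degrees add up to \<open>2 * n\<close> and neither exceeds \<open>n\<close>,
    so both equal \<open>n\<close> and the leading coefficients multiply to 1.\<close>
  have lead_q: "coeff q n = 1"
  proof -
    have "p * q \<noteq> 0" using lead_coeff_neg_root_poly[of "{1..2 * n}"] by (auto simp: pq)
    then have "degree p + degree q = degree (p * q)" by (simp add: degree_mult_eq)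
    then have "degree p + degree q = 2 * n" by (simp add: pq degree_neg_root_poly)
    with assms(1,2) have "degree p = n" "degree q = n" by auto
    then have "coeff (p * q) (n + n) = coeff p n * coeff q n"
      using coeff_mult_degree_sum[of p q] by simp
    then show ?thesis
      using assms(3) lead_coeff_neg_root_poly[of "{1..2 * n}"] by (simp add: pq mult_2)
  qed
  define Z where "Z r = {i \<in> {1..2 * n}. poly r (- real i) = 0}" for r :: "real poly"
  have Z_card: "card (Z r) \<le> n" if "degree r \<le> n" "coeff r n = 1" for r
  proof -
    have "r \<noteq> 0" using that by auto
    have "card (Z r) = card ((\<lambda>i. - real i) ` Z r)"
      by (subst card_image) (auto simp: inj_on_def)
    also have "\<dots> \<le> card {z. poly r z = 0}"
      by (rule card_mono) (auto simp: Z_def poly_roots_finite \<open>r \<noteq> 0\<close>)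
    also have "\<dots> \<le> degree r" using \<open>r \<noteq> 0\<close> by (rule card_poly_roots_bound)
    finally show ?thesis using that by simp
  qed
  have fin: "finite (Z r)" for r by (simp add: Z_def)
  have un: "Z p \<union> Z q = {1..2 * n}"
  proof -
    have "poly (p * q) (- real i) = 0" if "i \<in> {1..2 * n}" for i
      unfolding pq using that by (subst poly_neg_root_poly_eq_0_iff) auto
    then show ?thesis unfolding Z_def by fastforce
  qed
  \<comment> \<open>The left side is at least \<open>2 * n\<close> and the right side at most
    \<open>2 * n\<close>, so every bound is attained and the intersection is empty.\<close>
  have "card (Z p \<union> Z q) + card (Z p \<inter> Z q) = card (Z p) + card (Z q)"
    by (rule card_Un_Int[OF fin fin, symmetric])
  with un Z_card[OF assms(1,3)] Z_card[OF assms(2) lead_q]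
  have cards: "card (Z p) = n" "card (Z q) = n" "card (Z p \<inter> Z q) = 0" by auto
  then have "Z p \<inter> Z q = {}" using fin by simp
  with un have Zq: "Z q = {1..2 * n} - Z p" by auto
  show thesis
  proof
    show "Z p \<subseteq> {1..2 * n}" by (auto simp: Z_def)
    show "card (Z p) = n" by (fact cards)
    show "p = neg_root_poly (Z p)"
      using assms cards fin by (intro eq_neg_root_polyI) (auto simp: Z_def)
    have "q = neg_root_poly (Z q)"
      using assms lead_q cards fin by (intro eq_neg_root_polyI) (auto simp: Z_def)
    then show "q = neg_root_poly ({1..2 * n} - Z p)" using Zq by simp
  qed
qed

section \<open>The convolution system\<close>

definition coeffs_poly :: "nat \<Rightarrow> (nat \<Rightarrow> real) \<Rightarrow> real poly" where
  "coeffs_poly m c = (\<Sum>j = 1..m. monom (c j) (j - 1))"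

lemma coeff_coeffs_poly: "coeff (coeffs_poly m c) k = (if k < m then c (Suc k) else 0)"
proof -
  have "coeff (coeffs_poly m c) k = (\<Sum>j = 1..m. if j = Suc k then c j else 0)"
    unfolding coeffs_poly_def coeff_sum by (rule sum.cong) auto
  then show ?thesis by (simp add: Suc_le_eq)
qed

lemma degree_coeffs_poly: "degree (coeffs_poly m c) \<le> m - 1"
  by (rule degree_le) (auto simp: coeff_coeffs_poly)

lemma coeffs_poly_eqI:
  assumes "degree p < m" "\<And>j. j \<in> {1..m} \<Longrightarrow> c j = coeff p (j - 1)"
  shows "coeffs_poly m c = p"
  by (rule poly_eqI) (use assms in \<open>auto simp: coeff_coeffs_poly coeff_eq_0\<close>)

text \<open>Variables are indexed from 1, so \<open>(j - 1) + (k - 1) = i - 1\<close> becomes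
  \<open>j + k = i + 1\<close>. At \<open>i = 0\<close> truncated subtraction would break
  this.\<close>

lemma coeff_mult_coeffs_poly:
  assumes "i \<ge> 1"
  shows "coeff (coeffs_poly m c * coeffs_poly m d) (i - 1) =
    (\<Sum>(j, k)\<in>{1..m} \<times> {1..m}. of_bool (j + k = i + 1) * (c j * d k))"
proof -
  have "coeff (coeffs_poly m c * coeffs_poly m d) (i - 1) =
    (\<Sum>j = 1..m. \<Sum>k = 1..m. coeff (monom (c j * d k) (j - 1 + (k - 1))) (i - 1))"
    by (simp add: coeffs_poly_def sum_product mult_monom coeff_sum)
  also have "\<dots> = (\<Sum>j = 1..m. \<Sum>k = 1..m. of_bool (j + k = i + 1) * (c j * d k))"
    using assms by (intro sum.cong) auto
  finally show ?thesis by (simp only: sum.cartesian_product)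
qed

section \<open>Encoding the monomials and equations\<close>

definition pair_exponent :: "nat \<Rightarrow> nat \<times> nat \<Rightarrow> nat \<Rightarrow> nat" where
  "pair_exponent m = (\<lambda>(j, k). \<lambda>i\<in>{1..2 * m}. of_bool (i = j \<or> i = m + k))"

text \<open>
  The pair \<open>(m, m + 1)\<close> encodes the linear monomial \<open>x m\<close>, since the index \<open>m + (m + 1)\<close> is
  out of range. Its weight \<open>2 * m + 1\<close> occurs for no other pair, so that the single rule
  \<open>j + k = i + 1\<close> covers all equations, the last one being \<open>x m = 1\<close>.
\<close>
definition exponent_pairs :: "nat \<Rightarrow> (nat \<times> nat) set" where
  "exponent_pairs m = insert (m, m + 1) ({1..m} \<times> {1..m})"

text \<open>Coefficients are indexed by exponent vectors, so the pair behind a vector is recovered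
  by inverting \<open>pair_exponent\<close>, which is injective on the pairs used.\<close>

definition conv_coeff :: "nat \<Rightarrow> nat \<Rightarrow> (nat \<Rightarrow> nat) \<Rightarrow> real" where
  "conv_coeff m i \<alpha> =
     (case inv_into (exponent_pairs m) (pair_exponent m) \<alpha> of (j, k) \<Rightarrow> of_bool (j + k = i + 1))"

text \<open>The target polynomial has degree \<open>2 * m - 2\<close>. At \<open>i = 2 * m\<close>
  its coefficient is therefore 0, and the added 1 is the right-hand side of
  \<open>x m = 1\<close>.\<close>

definition conv_rhs :: "nat \<Rightarrow> nat \<Rightarrow> real" where
  "conv_rhs m i = coeff (neg_root_poly {1..2 * (m - 1)}) (i - 1) + of_bool (i = 2 * m)"

abbreviation conv_support :: "nat \<Rightarrow> (nat \<Rightarrow> nat) set" where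
  "conv_support m \<equiv> pair_exponent m ` exponent_pairs m"

text \<open>The support of the vector determines the pair: \<open>j\<close> is its only index up to
  \<open>m\<close>, and an empty upper half means \<open>k = m + 1\<close>.\<close>

lemma inj_on_pair_exponent: "inj_on (pair_exponent m) (exponent_pairs m)"
proof (rule inj_onI)
  fix s t assume s: "s \<in> exponent_pairs m" and t: "t \<in> exponent_pairs m"
    and eq: "pair_exponent m s = pair_exponent m t"
  obtain j k j' k' where st: "s = (j, k)" "t = (j', k')" by (metis surj_pair)
  have *: "(i = j \<or> i = m + k) \<longleftrightarrow> (i = j' \<or> i = m + k')" if "1 \<le> i" "i \<le> 2 * m" for i
  proof -
    have "of_bool (i = j \<or> i = m + k) = (of_bool (i = j' \<or> i = m + k') :: nat)"
      using fun_cong[OF eq, of i] that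
      unfolding st pair_exponent_def prod.case restrict_def by (simp only: atLeastAtMost_iff if_True simp_thms)
    then show ?thesis by (simp only: of_bool_eq_iff)
  qed
  show "s = t"
  proof (cases "m = 0")
    case True
    then show ?thesis using s t by (simp add: exponent_pairs_def)
  next
    case False
    then have range: "1 \<le> j" "j \<le> m" "1 \<le> k" "k \<le> m + 1" "1 \<le> j'" "j' \<le> m" "1 \<le> k'" "k' \<le> m + 1"
      using s t by (auto simp: st exponent_pairs_def)
    have "j = j'" using *[of j] range by linarith
    moreover have "k = k'"
      \<comment> \<open>Both instances are needed, since either of \<open>k\<close> and
        \<open>k'\<close> may be \<open>m + 1\<close>, which puts its index out of range.\<close>
      using *[of "m + k"] *[of "m + k'"] range by linarith
    ultimately show ?thesis by (simp add: st)
  qed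
qed

lemma monomial_pair_exponent:
  assumes "m \<ge> 1" "(j, k) \<in> exponent_pairs m"
  shows "monomial (2 * m) x (pair_exponent m (j, k)) = x j * (if k \<le> m then x (m + k) else 1)"
proof -
  have "monomial (2 * m) x (pair_exponent m (j, k)) =
    (\<Prod>i\<in>{1..2 * m}. if i \<in> {j, m + k} then x i else 1)"
    unfolding monomial_def by (rule prod.cong) (auto simp: pair_exponent_def)
  also have "\<dots> = prod x ({1..2 * m} \<inter> {j, m + k})"
    by (simp add: prod.inter_restrict)
  also have "{1..2 * m} \<inter> {j, m + k} = insert j (if k \<le> m then {m + k} else {})"
    using assms by (auto simp: exponent_pairs_def)
  finally show ?thesis using assms by (auto simp: exponent_pairs_def)
qed

section \<open>The system as a polynomial identity\<close>

lemma conv_lhs: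
  assumes "m \<ge> 1" "i \<in> {1..2 * m}"
  shows "(\<Sum>\<alpha>\<in>conv_support m. conv_coeff m i \<alpha> * monomial (2 * m) x \<alpha>) =
    coeff (coeffs_poly m x * coeffs_poly m (\<lambda>k. x (m + k))) (i - 1) + of_bool (i = 2 * m) * x m"
proof -
  have "(\<Sum>\<alpha>\<in>conv_support m. conv_coeff m i \<alpha> * monomial (2 * m) x \<alpha>) =
    (\<Sum>s\<in>exponent_pairs m. conv_coeff m i (pair_exponent m s) * monomial (2 * m) x (pair_exponent m s))"
    by (simp add: sum.reindex inj_on_pair_exponent)
  also have "\<dots> = (\<Sum>(j, k)\<in>exponent_pairs m.
      of_bool (j + k = i + 1) * (x j * (if k \<le> m then x (m + k) else 1)))"
    by (rule sum.cong)
      (auto simp: conv_coeff_def monomial_pair_exponent[OF assms(1)] inv_into_f_f[OF inj_on_pair_exponent])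
  \<comment> \<open>The extra pair is split off. Its weight \<open>m + (m + 1)\<close> equals
    \<open>i + 1\<close> only for \<open>i = 2 * m\<close>.\<close>
  also have "\<dots> = of_bool (i = 2 * m) * x m +
      (\<Sum>(j, k)\<in>{1..m} \<times> {1..m}. of_bool (j + k = i + 1) * (x j * x (m + k)))"
  proof -
    have "(\<Sum>(j, k)\<in>{1..m} \<times> {1..m}.
        of_bool (j + k = i + 1) * (x j * (if k \<le> m then x (m + k) else 1))) =
      (\<Sum>(j, k)\<in>{1..m} \<times> {1..m}. of_bool (j + k = i + 1) * (x j * x (m + k)))"
      by (rule sum.cong) auto
    then show ?thesis by (auto simp: exponent_pairs_def)
  qed
  finally show ?thesis using assms by (subst coeff_mult_coeffs_poly) auto
qed

lemma mem_positive_solutions_conv_iff: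
  assumes "m \<ge> 1"
  shows "x \<in> positive_solutions (2 * m) (conv_support m) (2 * m) (conv_coeff m) (conv_rhs m) \<longleftrightarrow>
    x \<in> positive_vectors (2 * m) \<and> x m = 1 \<and>
    coeffs_poly m x * coeffs_poly m (\<lambda>k. x (m + k)) = neg_root_poly {1..2 * (m - 1)}"
    (is "_ \<longleftrightarrow> _ \<and> _ \<and> ?pq = ?R")
proof -
  have pq0: "coeff ?pq k = 0" and R0: "coeff ?R k = 0" if "k \<ge> 2 * m - 1" for k
  proof -
    have "degree ?pq \<le> (m - 1) + (m - 1)"
      by (intro order.trans[OF degree_mult_le] add_mono degree_coeffs_poly)
    then show "coeff ?pq k = 0" using that assms by (intro coeff_eq_0) linarith
    show "coeff ?R k = 0"
      using that assms by (intro coeff_eq_0) (simp add: degree_neg_root_poly)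
  qed
  have "(\<forall>i\<in>{1..2 * m}. coeff ?pq (i - 1) + of_bool (i = 2 * m) * x m = conv_rhs m i) \<longleftrightarrow>
    x m = 1 \<and> ?pq = ?R"
  proof safe
    assume *: "\<forall>i\<in>{1..2 * m}. coeff ?pq (i - 1) + of_bool (i = 2 * m) * x m = conv_rhs m i"
    show "x m = 1"
      using bspec[OF *, of "2 * m"] assms pq0[of "2 * m - 1"] R0[of "2 * m - 1"]
      by (simp add: conv_rhs_def)
    show "?pq = ?R"
    proof (rule poly_eqI)
      fix k
      show "coeff ?pq k = coeff ?R k"
      proof (cases "k \<ge> 2 * m - 1")
        case False
        then have "Suc k < 2 * m" by linarith
        then show ?thesis using bspec[OF *, of "Suc k"] by (simp add: conv_rhs_def)
      qed (simp only: pq0 R0)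
    qed
  qed (auto simp: conv_rhs_def)
  then show ?thesis using assms by (simp add: positive_solutions_def conv_lhs)
qed

section \<open>Solutions as subsets of the roots\<close>

definition factor_vector :: "nat \<Rightarrow> nat set \<Rightarrow> nat \<Rightarrow> real" where
  "factor_vector m I = (\<lambda>i\<in>{1..2 * m}.
     if i \<le> m then coeff (neg_root_poly I) (i - 1)
     else coeff (neg_root_poly ({1..2 * (m - 1)} - I)) (i - m - 1))"

lemma coeffs_poly_factor_vector:
  assumes "m \<ge> 1" "I \<subseteq> {1..2 * (m - 1)}" "card I = m - 1"
  shows "coeffs_poly m (factor_vector m I) = neg_root_poly I"
    and "coeffs_poly m (\<lambda>k. factor_vector m I (m + k)) = neg_root_poly ({1..2 * (m - 1)} - I)"
proof -
  have "card ({1..2 * (m - 1)} - I) = m - 1"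
    using assms by (subst card_Diff_subset) (auto intro: finite_subset)
  then show "coeffs_poly m (factor_vector m I) = neg_root_poly I"
    "coeffs_poly m (\<lambda>k. factor_vector m I (m + k)) = neg_root_poly ({1..2 * (m - 1)} - I)"
    using assms by (auto intro!: coeffs_poly_eqI simp: degree_neg_root_poly factor_vector_def)
qed

lemma positive_solutions_conv:
  assumes "m \<ge> 1"
  shows "positive_solutions (2 * m) (conv_support m) (2 * m) (conv_coeff m) (conv_rhs m) =
    factor_vector m ` {I. I \<subseteq> {1..2 * (m - 1)} \<and> card I = m - 1}" (is "?Sol = _ ` ?F")
proof safe
  fix x assume "x \<in> ?Sol"
  then have x: "x \<in> positive_vectors (2 * m)" "x m = 1"
    "coeffs_poly m x * coeffs_poly m (\<lambda>k. x (m + k)) = neg_root_poly {1..2 * (m - 1)}"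
    using mem_positive_solutions_conv_iff[OF assms] by auto
  \<comment> \<open>The variable \<open>x m\<close> is the coefficient of degree
    \<open>m - 1\<close>, so \<open>x m = 1\<close> supplies the monicity that the factorization
    lemma asks for.\<close>
  have "coeff (coeffs_poly m x) (m - 1) = 1"
    using x assms by (simp add: coeff_coeffs_poly)
  then obtain I where I: "I \<subseteq> {1..2 * (m - 1)}" "card I = m - 1"
    "coeffs_poly m x = neg_root_poly I"
    "coeffs_poly m (\<lambda>k. x (m + k)) = neg_root_poly ({1..2 * (m - 1)} - I)"
    using neg_root_poly_factorization[OF degree_coeffs_poly degree_coeffs_poly _ x(3)] by blast
  have "x i = factor_vector m I i" for i
  proof (cases "i \<in> {1..2 * m}")
    case True
    have "coeff (neg_root_poly I) (i - 1) = x i" if "i \<le> m"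
      using that True by (subst I(3)[symmetric]) (auto simp: coeff_coeffs_poly)
    moreover have "coeff (neg_root_poly ({1..2 * (m - 1)} - I)) (i - m - 1) = x i" if "\<not> i \<le> m"
    proof -
      have "i - m - 1 < m" "m + Suc (i - m - 1) = i" using that True by auto
      then show ?thesis by (subst I(4)[symmetric]) (simp only: coeff_coeffs_poly if_True)
    qed
    ultimately show ?thesis using True by (simp add: factor_vector_def)
  next
    case False
    with x(1) have "x i = undefined" unfolding positive_vectors_def by (rule PiE_arb)
    then show ?thesis unfolding factor_vector_def restrict_def using False by (simp only: if_False)
  qed
  then show "x \<in> factor_vector m ` ?F" using I by blast
next
  fix I assume I: "I \<subseteq> {1..2 * (m - 1)}" "card I = m - 1"
  have fin: "finite I" using I(1) by (rule finite_subset) simp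
  let ?J = "{1..2 * (m - 1)} - I"
  have J: "card ?J = m - 1"
    using I fin by (simp add: card_Diff_subset)
  have "factor_vector m I \<in> positive_vectors (2 * m)"
    unfolding positive_vectors_def
  proof (rule PiE_I)
    fix i assume "i \<in> {1..2 * m}"
    then show "factor_vector m I i \<in> {0<..}"
      using I J fin by (auto simp: factor_vector_def intro!: coeff_neg_root_poly_pos)
  qed (auto simp: factor_vector_def)
  moreover have "factor_vector m I m = 1"
    using assms I lead_coeff_neg_root_poly[of I] by (simp add: factor_vector_def)
  moreover have "neg_root_poly I * neg_root_poly ?J = neg_root_poly {1..2 * (m - 1)}"
    unfolding neg_root_poly_def
    using prod.subset_diff[OF I(1), of "\<lambda>i. [:real i, 1:]"] by (simp add: mult.commute)
  ultimately show "factor_vector m I \<in> ?Sol"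
    using assms I by (simp add: mem_positive_solutions_conv_iff coeffs_poly_factor_vector)
qed

text \<open>The first half of the vector determines the polynomial \<open>neg_root_poly I\<close>,
  whose roots give back \<open>I\<close>.\<close>

lemma inj_on_factor_vector:
  assumes "m \<ge> 1"
  shows "inj_on (factor_vector m) {I. I \<subseteq> {1..2 * (m - 1)} \<and> card I = m - 1}"
proof (rule inj_onI, safe)
  fix I J i assume *: "I \<subseteq> {1..2 * (m - 1)}" "J \<subseteq> {1..2 * (m - 1)}" "card I = m - 1" "card J = m - 1"
    and eq: "factor_vector m I = factor_vector m J"
  then have "finite I" "finite J" by (auto intro: finite_subset)
  moreover have "neg_root_poly I = neg_root_poly J"
    using coeffs_poly_factor_vector(1)[OF assms *(1,3)] coeffs_poly_factor_vector(1)[OF assms *(2,4)] eq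
    by simp
  ultimately show "i \<in> I \<Longrightarrow> i \<in> J" "i \<in> J \<Longrightarrow> i \<in> I"
    using poly_neg_root_poly_eq_0_iff[of I i] poly_neg_root_poly_eq_0_iff[of J i] by auto
qed

section \<open>Bilinearity, signs and the count\<close>

theorem proposition10:
  fixes m :: nat
  assumes "m \<ge> 1"
  shows "\<exists>(S :: (nat \<Rightarrow> nat) set) (l :: nat) (a :: nat \<Rightarrow> (nat \<Rightarrow> nat) \<Rightarrow> real) (b :: nat \<Rightarrow> real).
           finite S \<and> S \<subseteq> exponent_vectors (2 * m) \<and> bilinear_exponents m S \<and>
           (\<forall>i\<in>{1..l}. \<forall>\<alpha>\<in>S. a i \<alpha> \<ge> 0) \<and>
           (\<forall>i\<in>{1..l}. b i > 0) \<and>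
           finite (positive_solutions (2 * m) S l a b) \<and>
           card (positive_solutions (2 * m) S l a b) = (2 * m - 2) choose (m - 1)"
proof (intro exI conjI)
  let ?F = "{I. I \<subseteq> {1..2 * (m - 1)} \<and> card I = m - 1}"
  have "finite ?F" by simp
  then show "finite (positive_solutions (2 * m) (conv_support m) (2 * m) (conv_coeff m) (conv_rhs m))"
    unfolding positive_solutions_conv[OF assms] by (rule finite_imageI)
  have "card ?F = (2 * m - 2) choose (m - 1)"
    using n_subsets[of "{1..2 * (m - 1)}" "m - 1"] by (simp add: diff_mult_distrib2)
  then show "card (positive_solutions (2 * m) (conv_support m) (2 * m) (conv_coeff m) (conv_rhs m)) =
      (2 * m - 2) choose (m - 1)"
    unfolding positive_solutions_conv[OF assms] by (simp only: card_image[OF inj_on_factor_vector[OF assms]])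
  show "finite (conv_support m)" by (simp add: exponent_pairs_def)
  show "conv_support m \<subseteq> exponent_vectors (2 * m)"
    by (auto simp: exponent_vectors_def pair_exponent_def)
  show "bilinear_exponents m (conv_support m)"
    unfolding bilinear_exponents_def
  proof safe
    fix j k assume jk: "(j, k) \<in> exponent_pairs m"
    have "(\<Sum>i = 1..m. pair_exponent m (j, k) i) = (\<Sum>i = 1..m. if i = j then 1 else 0)"
      using jk by (intro sum.cong) (auto simp: pair_exponent_def exponent_pairs_def)
    then show "(\<Sum>i = 1..m. pair_exponent m (j, k) i) \<le> 1" by simp
    \<comment> \<open>For the extra pair \<open>m + k\<close> is \<open>2 * m + 1\<close>, beyond
      the summation range, so this sum is 0.\<close>
    have "(\<Sum>i = m + 1..2 * m. pair_exponent m (j, k) i) =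
        (\<Sum>i = m + 1..2 * m. if i = m + k then 1 else 0)"
      using jk by (intro sum.cong) (auto simp: pair_exponent_def exponent_pairs_def)
    then show "(\<Sum>i = m + 1..2 * m. pair_exponent m (j, k) i) \<le> 1" by simp
  qed
  show "\<forall>i\<in>{1..2 * m}. \<forall>\<alpha>\<in>conv_support m. conv_coeff m i \<alpha> \<ge> 0"
    by (auto simp: conv_coeff_def split: prod.split)
  show "\<forall>i\<in>{1..2 * m}. conv_rhs m i > 0"
  proof
    fix i assume i: "i \<in> {1..2 * m}"
    let ?c = "coeff (neg_root_poly {1..2 * (m - 1)}) (i - 1)"
    \<comment> \<open>Here \<open>i - 1\<close> is at most the degree \<open>2 * m - 2\<close>; for
      \<open>i = 2 * m\<close> it is one more than the degree.\<close>
    have "?c > 0" if "i < 2 * m"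
      using that i by (intro coeff_neg_root_poly_pos) auto
    moreover have "?c = 0" if "i = 2 * m"
      using that assms by (intro coeff_eq_0) (simp add: degree_neg_root_poly)
    ultimately show "conv_rhs m i > 0"
      using i by (cases "i = 2 * m") (auto simp: conv_rhs_def)
  qed
qed

end
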